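(* Let $\mathcal{V}$ be a finite set of nodes with profiles over a schema of categorical attributes $\mathcal{A}=\{A_1,\ldots,A_m\}$, let $\lambda\ge 1$, and let $\omega_1,\ldots,\omega_m\in[0,1]$ with $\sum_{j=1}^m\omega_j=1$. Then the attribute-wise diversity function $div:2^{\mathcal{V}}\to\mathbb{R}$, $$div(S)=\sum_{j=1}^{m}\omega_j\, div_{A_j}(S),\qquad div_{A}(S)=\sum_{a\in dom_A(S)}\ \sum_{i=1}^{n_a}\frac{1}{i^{\lambda}},$$ is (nondecreasing) monotone and submodular.
   Context: $\mathcal{V}$ is the finite node set of a social network graph $\mathcal{G}_0=\langle\mathcal{V},\mathcal{E}\rangle$. Each attribute $A\in\mathcal{A}$ has a finite domain $dom_A$ of admissible values. Each node $v\in\mathcal{V}$ has a profile $\mathcal{A}[v]$ giving, for each attribute $A$, either a value $val_A(v)\in dom_A$ or a missing value $\bot$ (with $\bot\notin dom_A$). For $S\subseteq\mathcal{V}$, $dom_A(S)\subseteq dom_A$ is the set of values of $A$ that are associated with nodes in $S$, and $n_a=n_a(S)$ is the number of nodes in $S$ that have value $a$ for attribute $A$. A set function $F:2^{\mathcal{V}}\to\mathbb{R}$ is monotone if $F(S)\le F(T)$ whenever $S\subseteq T\subseteq\mathcal{V}$, and submodular if $F(S\cup\{v\})-F(S)\ge F(T\cup\{v\})-F(T)$ whenever $S\subseteq T\subseteq\mathcal{V}$ and $v\in\mathcal{V}\setminus T$. *)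

theory Defs
  imports Complex_Main
begin

text \<open>Set functions on the subsets of a ground set \<open>V\<close>, represented by functions on all sets of
  which only the values on subsets of \<open>V\<close> matter.\<close>

definition monotone_set_fun :: "'v set \<Rightarrow> ('v set \<Rightarrow> real) \<Rightarrow> bool" where
  "monotone_set_fun V F \<longleftrightarrow> (\<forall>S T. S \<subseteq> T \<and> T \<subseteq> V \<longrightarrow> F S \<le> F T)"

definition submodular :: "'v set \<Rightarrow> ('v set \<Rightarrow> real) \<Rightarrow> bool" where
  "submodular V F \<longleftrightarrow>
     (\<forall>S T v. S \<subseteq> T \<and> T \<subseteq> V \<and> v \<in> V - T \<longrightarrow>
        F (S \<union> {v}) - F S \<ge> F (T \<union> {v}) - F T)"

text \<open>\<open>Dom A\<close> is the set of admissible values of attribute \<open>A\<close>, and \<open>profile v A\<close> is the value of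
  \<open>A\<close> at node \<open>v\<close>, where \<open>None\<close> stands for a missing value. The domains of all attributes are sets
  over one common type \<open>'b\<close> of values, which is no restriction: different attributes may have
  overlapping or disjoint domains.\<close>

definition valid_profiles ::
  "'v set \<Rightarrow> 'a set \<Rightarrow> ('a \<Rightarrow> 'b set) \<Rightarrow> ('v \<Rightarrow> 'a \<Rightarrow> 'b option) \<Rightarrow> bool" where
  "valid_profiles V As Dom profile \<longleftrightarrow>
     (\<forall>v\<in>V. \<forall>A\<in>As. profile v A = None \<or> (\<exists>a\<in>Dom A. profile v A = Some a))"

definition dom_on ::
  "('a \<Rightarrow> 'b set) \<Rightarrow> ('v \<Rightarrow> 'a \<Rightarrow> 'b option) \<Rightarrow> 'a \<Rightarrow> 'v set \<Rightarrow> 'b set" where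
  "dom_on Dom profile A S = {a \<in> Dom A. \<exists>v\<in>S. profile v A = Some a}"

definition num_with_value :: "('v \<Rightarrow> 'a \<Rightarrow> 'b option) \<Rightarrow> 'a \<Rightarrow> 'b \<Rightarrow> 'v set \<Rightarrow> nat" where
  "num_with_value profile A a S = card {v \<in> S. profile v A = Some a}"

definition attr_diversity ::
  "('a \<Rightarrow> 'b set) \<Rightarrow> ('v \<Rightarrow> 'a \<Rightarrow> 'b option) \<Rightarrow> real \<Rightarrow> 'a \<Rightarrow> 'v set \<Rightarrow> real" where
  "attr_diversity Dom profile lam A S =
     (\<Sum>a\<in>dom_on Dom profile A S. \<Sum>i=1..num_with_value profile A a S. 1 / (real i powr lam))"

definition diversity ::
  "('a \<Rightarrow> 'b set) \<Rightarrow> ('v \<Rightarrow> 'a \<Rightarrow> 'b option) \<Rightarrow> real \<Rightarrow> nat \<Rightarrow> (nat \<Rightarrow> 'a) \<Rightarrow> (nat \<Rightarrow> real)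
     \<Rightarrow> 'v set \<Rightarrow> real" where
  "diversity Dom profile lam m A \<omega> S =
     (\<Sum>j=1..m. \<omega> j * attr_diversity Dom profile lam (A j) S)"

end

theory Submission
  imports Defs
begin

text \<open>Since a value that does not occur in \<open>S\<close> contributes an empty inner sum, \<open>attr_diversity\<close> may be summed
  over the fixed index set \<open>Dom A\<close>. The diversity is thus a nonnegative combination of functions
  \<open>S \<mapsto> H (card {v \<in> S. P v})\<close> with \<open>H n = 1 + 1/2\<^sup>\<lambda> + \<dots> + 1/n\<^sup>\<lambda>\<close>, and such a function is monotone
  and submodular because the increments of \<open>H\<close> are nonnegative and nonincreasing.\<close>

text \<open>Serves at two levels: with unit weights over the values of one attribute, and with
  weights \<open>\<omega> j\<close> over the attributes. The same holds for its submodular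
  counterpart.\<close>

lemma monotone_set_fun_sum:
  assumes "\<And>i. i \<in> I \<Longrightarrow> 0 \<le> c i" "\<And>i. i \<in> I \<Longrightarrow> monotone_set_fun V (F i)"
  shows "monotone_set_fun V (\<lambda>S. \<Sum>i\<in>I. c i * F i S)"
  using assms unfolding monotone_set_fun_def by (auto intro!: sum_mono mult_left_mono)

lemma submodular_sum:
  assumes c: "\<And>i. i \<in> I \<Longrightarrow> 0 \<le> c i" and F: "\<And>i. i \<in> I \<Longrightarrow> submodular V (F i)"
  shows "submodular V (\<lambda>S. \<Sum>i\<in>I. c i * F i S)"
  unfolding submodular_def
proof (intro allI impI)
  fix S T v
  assume ST: "S \<subseteq> T \<and> T \<subseteq> V \<and> v \<in> V - T"
  \<comment> \<open>Marginal gains are linear in the set function, so they can be compared term by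
    term.\<close>
  have "(\<Sum>i\<in>I. c i * (F i (T \<union> {v}) - F i T)) \<le> (\<Sum>i\<in>I. c i * (F i (S \<union> {v}) - F i S))"
  proof (rule sum_mono)
    fix i assume "i \<in> I"
    then show "c i * (F i (T \<union> {v}) - F i T) \<le> c i * (F i (S \<union> {v}) - F i S)"
      using F[of i] c[of i] ST unfolding submodular_def by (intro mult_left_mono) blast+
  qed
  then show "(\<Sum>i\<in>I. c i * F i (S \<union> {v})) - (\<Sum>i\<in>I. c i * F i S)
      \<ge> (\<Sum>i\<in>I. c i * F i (T \<union> {v})) - (\<Sum>i\<in>I. c i * F i T)"
    by (simp add: right_diff_distrib sum_subtractf)
qed

lemma monotone_set_fun_partial_sum_card:
  fixes f :: "nat \<Rightarrow> real"
  assumes "finite V" "\<And>i. 0 \<le> f i"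
  shows "monotone_set_fun V (\<lambda>S. \<Sum>i=1..card {v \<in> S. P v}. f i)"
  unfolding monotone_set_fun_def
proof (intro allI impI)
  fix S T assume "S \<subseteq> T \<and> T \<subseteq> V"
  then have "card {v \<in> S. P v} \<le> card {v \<in> T. P v}"
    using assms(1) by (intro card_mono) (auto intro: finite_subset)
  then show "(\<Sum>i=1..card {v \<in> S. P v}. f i) \<le> (\<Sum>i=1..card {v \<in> T. P v}. f i)"
    using assms(2) by (intro sum_mono2) auto
qed

text \<open>A new node satisfying \<open>P\<close> gains the next term of \<open>f\<close>, and the
  smaller set is at an earlier or equal index, where \<open>f\<close> is at least as large. The
  decrease of \<open>f\<close> is asked from index 1 on because \<open>1 / (real 0 powr lam)\<close>
  is 0 in HOL, below the term at 1.\<close>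

lemma submodular_partial_sum_card:
  fixes f :: "nat \<Rightarrow> real"
  assumes V: "finite V" and f: "\<And>i j. 1 \<le> i \<Longrightarrow> i \<le> j \<Longrightarrow> f j \<le> f i"
  shows "submodular V (\<lambda>S. \<Sum>i=1..card {v \<in> S. P v}. f i)"
  unfolding submodular_def
proof (intro allI impI)
  fix S T v
  assume ST: "S \<subseteq> T \<and> T \<subseteq> V \<and> v \<in> V - T"
  \<comment> \<open>Stated for all \<open>U \<subseteq> T\<close> to cover both \<open>S\<close> and
    \<open>T\<close>; since \<open>v\<close> lies outside \<open>U\<close>, the count rises by
    exactly one when \<open>P v\<close> holds.\<close>
  have gain: "(\<Sum>i=1..card {u \<in> U \<union> {v}. P u}. f i) - (\<Sum>i=1..card {u \<in> U. P u}. f i)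
      = (if P v then f (Suc (card {u \<in> U. P u})) else 0)" if "U \<subseteq> T" for U
  proof -
    have "finite U" "v \<notin> U"
      using that ST V by (auto intro: finite_subset)
    moreover have "{u \<in> U \<union> {v}. P u} = (if P v then insert v {u \<in> U. P u} else {u \<in> U. P u})"
      by auto
    ultimately show ?thesis by simp
  qed
  have "card {u \<in> S. P u} \<le> card {u \<in> T. P u}"
    using ST V by (intro card_mono) (auto intro: finite_subset)
  then show "(\<Sum>i=1..card {u \<in> S \<union> {v}. P u}. f i) - (\<Sum>i=1..card {u \<in> S. P u}. f i)
      \<ge> (\<Sum>i=1..card {u \<in> T \<union> {v}. P u}. f i) - (\<Sum>i=1..card {u \<in> T. P u}. f i)"
    using ST gain[of S] gain[of T] f by simp
qed

text \<open>The factor \<open>1\<close> gives the sum the weighted shape \<open>c i * F i S\<close>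
  of the combination lemmas.\<close>

lemma attr_diversity_eq_sum_Dom:
  assumes "finite (Dom A)"
  shows "attr_diversity Dom profile lam A S =
    (\<Sum>a\<in>Dom A. 1 * (\<Sum>i=1..card {v \<in> S. profile v A = Some a}. 1 / (real i powr lam)))"
  unfolding attr_diversity_def num_with_value_def mult_1
proof (rule sum.mono_neutral_left)
  show "\<forall>a\<in>Dom A - dom_on Dom profile A S.
      (\<Sum>i=1..card {v \<in> S. profile v A = Some a}. 1 / (real i powr lam)) = 0"
  proof
    fix a assume "a \<in> Dom A - dom_on Dom profile A S"
    then have "{v \<in> S. profile v A = Some a} = {}"
      by (auto simp: dom_on_def)
    then show "(\<Sum>i=1..card {v \<in> S. profile v A = Some a}. 1 / (real i powr lam)) = 0"
      by (simp only: card.empty) simp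
  qed
qed (use assms in \<open>auto simp: dom_on_def\<close>)

text \<open>Monotonicity rests on the terms \<open>1 / (real i powr lam)\<close> being nonnegative,
  submodularity on their being nonincreasing from index 1 on, which follows from
  \<open>0 \<le> lam\<close>.\<close>

lemma
  assumes "finite V" "finite (Dom A)"
  shows monotone_attr_diversity: "monotone_set_fun V (attr_diversity Dom profile lam A)"
    and submodular_attr_diversity: "0 \<le> lam \<Longrightarrow> submodular V (attr_diversity Dom profile lam A)"
proof -
  \<comment> \<open>Extensionality turns the identity at each \<open>S\<close> into one between set
    functions, so that it can rewrite the unapplied \<open>attr_diversity\<close>.\<close>
  note eq = attr_diversity_eq_sum_Dom[of Dom A profile lam, OF assms(2), THEN ext]
  show "monotone_set_fun V (attr_diversity Dom profile lam A)"
    unfolding eq using assms(1)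
    by (intro monotone_set_fun_sum monotone_set_fun_partial_sum_card) auto
  show "submodular V (attr_diversity Dom profile lam A)" if "0 \<le> lam"
    unfolding eq using assms(1) that
    by (intro submodular_sum submodular_partial_sum_card)
      (auto intro!: divide_left_mono powr_mono2)
qed

theorem proposition1:
  fixes V :: "'v set"
    and m :: nat
    and A :: "nat \<Rightarrow> 'a"
    and Dom :: "'a \<Rightarrow> 'b set"
    and profile :: "'v \<Rightarrow> 'a \<Rightarrow> 'b option"
    and lam :: real
    and \<omega> :: "nat \<Rightarrow> real"
  assumes "finite V"
    and "inj_on A {1..m}"
    and "\<And>j. j \<in> {1..m} \<Longrightarrow> finite (Dom (A j))"
    and "valid_profiles V (A ` {1..m}) Dom profile"
    and "lam \<ge> 1"
    and "\<And>j. j \<in> {1..m} \<Longrightarrow> \<omega> j \<in> {0..1}"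
    and "(\<Sum>j=1..m. \<omega> j) = 1"
  shows "monotone_set_fun V (diversity Dom profile lam m A \<omega>) \<and>
         submodular V (diversity Dom profile lam m A \<omega>)"
proof -
  have eq: "diversity Dom profile lam m A \<omega> =
      (\<lambda>S. \<Sum>j\<in>{1..m}. \<omega> j * attr_diversity Dom profile lam (A j) S)"
    by (rule ext) (simp add: diversity_def)
  have \<omega>: "0 \<le> \<omega> j" if "j \<in> {1..m}" for j
    using assms(6)[OF that] by simp
  show ?thesis
    unfolding eq using assms(1,3,5) \<omega>
    by (intro conjI monotone_set_fun_sum submodular_sum
        monotone_attr_diversity submodular_attr_diversity) auto
qed

end
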